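(* Assume that $X=(W,Q,\pi,I)\in\mathscr D_{fin}$ with $\pi=w_0$ (the longest element of $W$) is flipped to $Y=(W,Q,\pi,(I\setminus\{i\})\cup\{i'\})$ by the flat $\{i,i'\}$ for a special vertex $i$ of $\Gamma_X$. Then the subquiver categories $\mathcal S_X$ and $\mathcal S_Y$ are isomorphic.
   Context: Quadruples. For a Coxeter group $W$ of finite rank with simple reflections $s_1,\dots,s_n$, let $V$ be the real vector space with basis the simple roots $\alpha_1,\dots,\alpha_n$, with the form $\langle\alpha_i,\alpha_j\rangle=-\cos(\pi/\operatorname{ord}(s_is_j))$ and the usual geometric action of $W$. Write $[m]=\{1,\dots,m\}$. For a word $Q=s_{i_1}\cdots s_{i_m}$ and $\pi\in W$, the subword complex $\mathcal{SC}_W(Q,\pi)$ has as faces the subsets $I\subseteq[m]$ such that the subword of $Q$ at positions $[m]\setminus I$ contains a reduced expression of $\pi$. A quadruple is $X=(W,Q,\pi,I)$ with $I$ a maximal face of $\mathcal{SC}_W(Q,\pi)$. The root function is $r_X(l)=\big(\prod_{j\in[l-1]\setminus I}s_{i_j}\big)(\alpha_{i_l})$, $l\in[m]$ (product in increasing order of $j$). $X$ is irreducible if $\{r_X(i)\}_{i\in I}$ spans $V$; it is moreover root independent if $\{r_X(i)\}_{i\in I}$ is a basis of $V$. $\mathscr D_{fin}$ consists of the root independent irreducible quadruples with $W$ finite. Root configuration quiver. $\Gamma_X$ has vertex set (labelled by) $I$, and there is a (single) arrow $i\to j$ if and only if $(i-j)\cdot\langle r_X(i),r_X(j)\rangle>0$.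 The subobjects of $X$ are indexed by subsets $J\subseteq I$; the subobject $X(J)$ has root configuration quiver $\Gamma_{X(J)}$, identified with the full subquiver of $\Gamma_X$ on $J$. Flips. The flat of a subspace $U\subseteq V$ is $\{l\in[m]:r_X(l)\in U\}$. For $i\in I$, $i'$ denotes the unique index in $[m]\setminus I$ such that $\{i,i'\}$ is a flippable flat of $X$, i.e. such that $\{i,i'\}$ is the flat of the line $\mathbb R r_X(i)$. The flip of $X$ by $\{i,i'\}$ replaces the maximal face $I$ by $(I\setminus\{i\})\cup\{i'\}$. The reflection interval of the flip is $[i,i']$ if $i<i'$ and $[i',i]$ if $i'<i$; the stable interval is its complement in $[m]$. A vertex $i$ of $\Gamma_X$ is special if the vertices adjacent to $i$ in $\Gamma_X$ are either all in the reflection interval or all in the stable interval of the flip $\{i,i'\}$. $\mathcal S_X$: objects are finite disjoint unions $\bigsqcup_{i=1}^t\Gamma_{X(J_i)}$ of labelled quivers, $J_i\subseteq I$ (repetitions allowed); morphisms $A\to B$ are label-preserving partial isomorphisms, i.e. diagrams $A\hookleftarrow P\hookrightarrow B$ given by an $I$-labelled quiver $P$ identified, preserving labels, with a (full) subquiver of $A$ and of $B$; the composite of $A\hookleftarrow P\hookrightarrow B$ and $B\hookleftarrow P'\hookrightarrow C$ is given by the intersection of $P$ and $P'$ in $B$. $\mathcal S_Y$ is defined in the same way from $Y$. *)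

theory Defs
  imports "HOL-Analysis.Analysis" "HOL-Algebra.Multiplicative_Group" "HOL-Library.Sublist"
begin

section \<open>Coxeter systems\<close>

definition word_val :: "('w, 'x) monoid_scheme \<Rightarrow> ('n \<Rightarrow> 'w) \<Rightarrow> 'n list \<Rightarrow> 'w" where
  "word_val W s u = foldr (\<lambda>i g. s i \<otimes>\<^bsub>W\<^esub> g) u \<one>\<^bsub>W\<^esub>"

text \<open>The order is 0 when \<open>s i \<otimes> s j\<close> has infinite order.\<close>

definition cox_ord :: "('w, 'x) monoid_scheme \<Rightarrow> ('n \<Rightarrow> 'w) \<Rightarrow> 'n \<Rightarrow> 'n \<Rightarrow> nat" where
  "cox_ord W s i j = group.ord W (s i \<otimes>\<^bsub>W\<^esub> s j)"

text \<open>
  The monoid congruence on words generated by the relators \<open>(i j)\<^bsup>m i j\<^esup>\<close>.  Since \<open>m i i = 1\<close> gives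
  the relator \<open>i i\<close>, the quotient monoid is the group with these generators and relations, and no
  formal inverses are needed.  For \<open>m i j = 0\<close> (infinite order) the relator is empty.
\<close>

inductive cox_cong :: "('n \<Rightarrow> 'n \<Rightarrow> nat) \<Rightarrow> 'n list \<Rightarrow> 'n list \<Rightarrow> bool" for m where
  refl: "cox_cong m u u"
| sym: "cox_cong m u v \<Longrightarrow> cox_cong m v u"
| trans: "cox_cong m u v \<Longrightarrow> cox_cong m v w \<Longrightarrow> cox_cong m u w"
| relator: "cox_cong m (u @ concat (replicate (m i j) [i, j]) @ v) (u @ v)"

text \<open>
  A group generated by pairwise distinct elements \<open>s i\<close> of order 2 and presented by the relations
  \<open>(s i \<otimes> s j)\<^bsup>ord (s i \<otimes> s j)\<^esup> = \<one>\<close>.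
\<close>

locale coxeter_system = group W for W :: "'w monoid" (structure) +
  fixes s :: "'n::finite \<Rightarrow> 'w"
  assumes simple_closed: "s i \<in> carrier W"
    and simple_ne_one: "s i \<noteq> \<one>"
    and simple_square: "s i \<otimes> s i = \<one>"
    and simple_inj: "inj s"
    and simple_generate: "generate W (range s) = carrier W"
    and presentation: "word_val W s u = word_val W s v \<Longrightarrow> cox_cong (cox_ord W s) u v"

definition cox_length :: "'w monoid \<Rightarrow> ('n \<Rightarrow> 'w) \<Rightarrow> 'w \<Rightarrow> nat" where
  "cox_length W s w = (LEAST k. \<exists>u. length u = k \<and> word_val W s u = w)"

definition reduced_expression :: "'w monoid \<Rightarrow> ('n \<Rightarrow> 'w) \<Rightarrow> 'w \<Rightarrow> 'n list \<Rightarrow> bool" where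
  "reduced_expression W s w u \<longleftrightarrow> word_val W s u = w \<and> length u = cox_length W s w"

definition longest_element :: "'w monoid \<Rightarrow> ('n \<Rightarrow> 'w) \<Rightarrow> 'w \<Rightarrow> bool" where
  "longest_element W s w \<longleftrightarrow>
     w \<in> carrier W \<and> (\<forall>v\<in>carrier W. cox_length W s v \<le> cox_length W s w)"

section \<open>Geometric representation\<close>

text \<open>
  The space \<open>V\<close> is \<open>real ^ 'n\<close>, with the coordinate vectors as simple roots.  In the infinite-order
  case \<open>pi / 0 = 0\<close>, so the form takes the usual value \<open>-1\<close>.
\<close>

definition simple_root :: "'n::finite \<Rightarrow> real ^ 'n" where
  "simple_root i = axis i 1"

definition cox_form :: "'w monoid \<Rightarrow> ('n::finite \<Rightarrow> 'w) \<Rightarrow> real ^ 'n \<Rightarrow> real ^ 'n \<Rightarrow> real" where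
  "cox_form W s x y =
     (\<Sum>i\<in>UNIV. \<Sum>j\<in>UNIV. x $ i * y $ j * (- cos (pi / real (cox_ord W s i j))))"

definition simple_reflection ::
  "'w monoid \<Rightarrow> ('n::finite \<Rightarrow> 'w) \<Rightarrow> 'n \<Rightarrow> real ^ 'n \<Rightarrow> real ^ 'n" where
  "simple_reflection W s i v = v - (2 * cox_form W s v (simple_root i)) *\<^sub>R simple_root i"

text \<open>
  The action on \<open>V\<close> of the product of simple reflections spelled by a word; its last letter acts
  first.
\<close>

definition word_action ::
  "'w monoid \<Rightarrow> ('n::finite \<Rightarrow> 'w) \<Rightarrow> 'n list \<Rightarrow> real ^ 'n \<Rightarrow> real ^ 'n" where
  "word_action W s u v = foldr (simple_reflection W s) u v"

section \<open>Subword complexes and quadruples\<close>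

text \<open>
  A word \<open>Q\<close> in the simple reflections is given by the list of their indices.  Positions are
  counted from 0, so \<open>[m]\<close> becomes \<open>{..<length Q}\<close>, and \<open>nths Q (- I)\<close> is the subword at the
  positions outside \<open>I\<close>.
\<close>

definition subword_complex ::
  "'w monoid \<Rightarrow> ('n \<Rightarrow> 'w) \<Rightarrow> 'n list \<Rightarrow> 'w \<Rightarrow> nat set set" where
  "subword_complex W s Q p =
     {I. I \<subseteq> {..<length Q} \<and> (\<exists>u. subseq u (nths Q (- I)) \<and> reduced_expression W s p u)}"

definition maximal_face :: "nat set set \<Rightarrow> nat set \<Rightarrow> bool" where
  "maximal_face K I \<longleftrightarrow> I \<in> K \<and> (\<forall>J\<in>K. I \<subseteq> J \<longrightarrow> J = I)"

record ('w, 'n) quadruple =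
  qgroup :: "'w monoid"
  qsimple :: "'n \<Rightarrow> 'w"
  qword :: "'n list"
  qelem :: 'w
  qface :: "nat set"

definition is_quadruple :: "('w, 'n::finite) quadruple \<Rightarrow> bool" where
  "is_quadruple X \<longleftrightarrow>
     coxeter_system (qgroup X) (qsimple X) \<and> qelem X \<in> carrier (qgroup X) \<and>
     maximal_face (subword_complex (qgroup X) (qsimple X) (qword X) (qelem X)) (qface X)"

definition root_fun :: "('w, 'n::finite) quadruple \<Rightarrow> nat \<Rightarrow> real ^ 'n" where
  "root_fun X l =
     word_action (qgroup X) (qsimple X) (nths (take l (qword X)) (- qface X))
       (simple_root (qword X ! l))"

definition irreducible_quadruple :: "('w, 'n::finite) quadruple \<Rightarrow> bool" where
  "irreducible_quadruple X \<longleftrightarrow> span (root_fun X ` qface X) = UNIV"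

text \<open>The basis condition is on the family \<open>root_fun X i\<close>, whence the injectivity requirement.\<close>

definition root_independent :: "('w, 'n::finite) quadruple \<Rightarrow> bool" where
  "root_independent X \<longleftrightarrow>
     inj_on (root_fun X) (qface X) \<and> independent (root_fun X ` qface X) \<and>
     span (root_fun X ` qface X) = UNIV"

definition D_fin :: "('w, 'n::finite) quadruple set" where
  "D_fin = {X. is_quadruple X \<and> irreducible_quadruple X \<and> root_independent X \<and>
               finite (carrier (qgroup X))}"

section \<open>Labelled quivers\<close>

text \<open>
  Quivers without multiple arrows.  Label functions are kept \<open>undefined\<close> off the vertex set, so that
  equality of records is equality of labelled quivers.
\<close>

record ('v, 'l) quiver =
  verts :: "'v set"
  arrows :: "('v \<times> 'v) set"
  label :: "'v \<Rightarrow> 'l"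

definition full_subquiver :: "('v, 'l) quiver \<Rightarrow> 'v set \<Rightarrow> ('v, 'l) quiver" where
  "full_subquiver G J =
     \<lparr>verts = verts G \<inter> J, arrows = arrows G \<inter> (J \<times> J), label = restrict (label G) (verts G \<inter> J)\<rparr>"

definition disjoint_union :: "('v, 'l) quiver list \<Rightarrow> (nat \<times> 'v, 'l) quiver" where
  "disjoint_union Gs =
     \<lparr>verts = (SIGMA k:{..<length Gs}. verts (Gs ! k)),
      arrows = {((k, a), (k, b)) |k a b. k < length Gs \<and> (a, b) \<in> arrows (Gs ! k)},
      label = restrict (\<lambda>(k, a). label (Gs ! k) a) (SIGMA k:{..<length Gs}. verts (Gs ! k))\<rparr>"

text \<open>
  A partial isomorphism is recorded by its graph.  Its domain and range are the vertex sets of the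
  full subquivers of \<open>A\<close> and \<open>B\<close> that it identifies with each other; \<open>(O)\<close> intersects the range of
  one partial isomorphism with the domain of the next.
\<close>

definition partial_isos :: "('v, 'l) quiver \<Rightarrow> ('v, 'l) quiver \<Rightarrow> ('v \<times> 'v) set set" where
  "partial_isos A B =
     {f. f \<subseteq> verts A \<times> verts B \<and> single_valued f \<and> single_valued (f\<inverse>) \<and>
         (\<forall>a b. (a, b) \<in> f \<longrightarrow> label A a = label B b) \<and>
         (\<forall>a b a' b'. (a, b) \<in> f \<longrightarrow> (a', b') \<in> f \<longrightarrow>
            ((a, a') \<in> arrows A \<longleftrightarrow> (b, b') \<in> arrows B))}"

definition root_quiver :: "('w, 'n::finite) quadruple \<Rightarrow> (nat, nat) quiver" where
  "root_quiver X =
     \<lparr>verts = qface X,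
      arrows = {(i, j). i \<in> qface X \<and> j \<in> qface X \<and>
        (real i - real j) * cox_form (qgroup X) (qsimple X) (root_fun X i) (root_fun X j) > 0},
      label = restrict id (qface X)\<rparr>"

text \<open>The root configuration quiver of the subobject \<open>X(J)\<close>, as the full subquiver on \<open>J\<close>.\<close>

definition subobject_quiver :: "('w, 'n::finite) quadruple \<Rightarrow> nat set \<Rightarrow> (nat, nat) quiver" where
  "subobject_quiver X J = full_subquiver (root_quiver X) J"

section \<open>Flips\<close>

definition flat :: "('w, 'n::finite) quadruple \<Rightarrow> (real ^ 'n) set \<Rightarrow> nat set" where
  "flat X U = {l. l < length (qword X) \<and> root_fun X l \<in> U}"

definition flippable_flat :: "('w, 'n::finite) quadruple \<Rightarrow> nat \<Rightarrow> nat \<Rightarrow> bool" where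
  "flippable_flat X i i' \<longleftrightarrow>
     i \<in> qface X \<and> i' \<in> {..<length (qword X)} - qface X \<and> flat X (span {root_fun X i}) = {i, i'}"

definition reflection_interval :: "nat \<Rightarrow> nat \<Rightarrow> nat set" where
  "reflection_interval i i' = (if i < i' then {i..i'} else {i'..i})"

definition stable_interval :: "('w, 'n) quadruple \<Rightarrow> nat \<Rightarrow> nat \<Rightarrow> nat set" where
  "stable_interval X i i' = {..<length (qword X)} - reflection_interval i i'"

definition adjacent :: "('v, 'l) quiver \<Rightarrow> 'v \<Rightarrow> 'v set" where
  "adjacent G i = {j. (i, j) \<in> arrows G \<or> (j, i) \<in> arrows G}"

definition special_vertex :: "('w, 'n::finite) quadruple \<Rightarrow> nat \<Rightarrow> bool" where
  "special_vertex X i \<longleftrightarrow>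
     (\<exists>i'. flippable_flat X i i' \<and>
        (adjacent (root_quiver X) i \<subseteq> reflection_interval i i' \<or>
         adjacent (root_quiver X) i \<subseteq> stable_interval X i i'))"

section \<open>Categories\<close>

text \<open>\<open>Comp C a b c f g\<close> is the composite of \<open>f : a \<rightarrow> b\<close> followed by \<open>g : b \<rightarrow> c\<close>.\<close>

record ('o, 'm) cat =
  Obj :: "'o set"
  Hom :: "'o \<Rightarrow> 'o \<Rightarrow> 'm set"
  Ide :: "'o \<Rightarrow> 'm"
  Comp :: "'o \<Rightarrow> 'o \<Rightarrow> 'o \<Rightarrow> 'm \<Rightarrow> 'm \<Rightarrow> 'm"

definition is_category :: "('o, 'm) cat \<Rightarrow> bool" where
  "is_category C \<longleftrightarrow>
     (\<forall>a\<in>Obj C. Ide C a \<in> Hom C a a) \<and>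
     (\<forall>a\<in>Obj C. \<forall>b\<in>Obj C. \<forall>c\<in>Obj C. \<forall>f\<in>Hom C a b. \<forall>g\<in>Hom C b c.
        Comp C a b c f g \<in> Hom C a c) \<and>
     (\<forall>a\<in>Obj C. \<forall>b\<in>Obj C. \<forall>f\<in>Hom C a b.
        Comp C a a b (Ide C a) f = f \<and> Comp C a b b f (Ide C b) = f) \<and>
     (\<forall>a\<in>Obj C. \<forall>b\<in>Obj C. \<forall>c\<in>Obj C. \<forall>d\<in>Obj C.
        \<forall>f\<in>Hom C a b. \<forall>g\<in>Hom C b c. \<forall>h\<in>Hom C c d.
        Comp C a c d (Comp C a b c f g) h = Comp C a b d f (Comp C b c d g h))"

text \<open>A functor that is bijective on objects and on every hom-set.\<close>

definition isomorphic_categories :: "('o, 'm) cat \<Rightarrow> ('p, 'q) cat \<Rightarrow> bool" where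
  "isomorphic_categories C D \<longleftrightarrow>
     (\<exists>F G. bij_betw F (Obj C) (Obj D) \<and>
        (\<forall>a\<in>Obj C. \<forall>b\<in>Obj C. bij_betw (G a b) (Hom C a b) (Hom D (F a) (F b))) \<and>
        (\<forall>a\<in>Obj C. G a a (Ide C a) = Ide D (F a)) \<and>
        (\<forall>a\<in>Obj C. \<forall>b\<in>Obj C. \<forall>c\<in>Obj C. \<forall>f\<in>Hom C a b. \<forall>g\<in>Hom C b c.
           G a c (Comp C a b c f g) = Comp D (F a) (F b) (F c) (G a b f) (G b c g)))"

definition subquiver_category ::
  "('w, 'n::finite) quadruple \<Rightarrow> ((nat \<times> nat, nat) quiver, ((nat \<times> nat) \<times> (nat \<times> nat)) set) cat" where
  "subquiver_category X =
     \<lparr>Obj = {disjoint_union (map (subobject_quiver X) Js) |Js. \<forall>J\<in>set Js. J \<subseteq> qface X},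
      Hom = partial_isos,
      Ide = (\<lambda>A. Id_on (verts A)),
      Comp = (\<lambda>A B C f g. f O g)\<rparr>"

lemma partial_isos_comp:
  assumes f: "f \<in> partial_isos A B" and g: "g \<in> partial_isos B C"
  shows "f O g \<in> partial_isos A C"
proof (unfold partial_isos_def, intro CollectI conjI allI impI)
  show "single_valued (f O g)" "single_valued ((f O g)\<inverse>)"
    using f g by (simp_all add: partial_isos_def converse_relcomp single_valued_relcomp)
  show "f O g \<subseteq> verts A \<times> verts C"
    using f g unfolding partial_isos_def by blast
next
  fix a c assume "(a, c) \<in> f O g"
  then obtain b where "(a, b) \<in> f" "(b, c) \<in> g" by (rule relcompEpair)
  then have "label A a = label B b" "label B b = label C c"
    using f g unfolding partial_isos_def by blast+
  then show "label A a = label C c" by simp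
next
  fix a c a' c' assume ac: "(a, c) \<in> f O g" and ac': "(a', c') \<in> f O g"
  obtain b where b: "(a, b) \<in> f" "(b, c) \<in> g" using ac by (rule relcompEpair)
  obtain b' where b': "(a', b') \<in> f" "(b', c') \<in> g" using ac' by (rule relcompEpair)
  have "(a, a') \<in> arrows A \<longleftrightarrow> (b, b') \<in> arrows B"
    using f b(1) b'(1) by (simp add: partial_isos_def)
  also have "\<dots> \<longleftrightarrow> (c, c') \<in> arrows C"
    using g b(2) b'(2) by (simp add: partial_isos_def)
  finally show "(a, a') \<in> arrows A \<longleftrightarrow> (c, c') \<in> arrows C" .
qed

lemma partial_isos_id: "Id_on (verts A) \<in> partial_isos A A"
  by (auto simp: partial_isos_def single_valued_def)

lemma is_category_subquiver_category: "is_category (subquiver_category X)"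
proof -
  have L: "Id_on (verts A) O f = f" if "f \<in> partial_isos A B"
    for A B :: "(nat \<times> nat, nat) quiver" and f
    using that unfolding partial_isos_def by blast
  have R: "f O Id_on (verts B) = f" if "f \<in> partial_isos A B"
    for A B :: "(nat \<times> nat, nat) quiver" and f
    using that unfolding partial_isos_def by blast
  show ?thesis
    unfolding is_category_def subquiver_category_def
    by (simp add: partial_isos_id partial_isos_comp L R O_assoc)
qed

end

theory Submission
  imports Defs
begin

text \<open>
  Let \<open>\<beta>\<close> be the root \<open>r\<^sub>X(i)\<close> and \<open>\<sigma>\<close> the reflection in \<open>\<beta>\<close>.  The two words that define \<open>r\<^sub>X(l)\<close>
  and \<open>r\<^sub>Y(l)\<close> differ by at most one letter at \<open>i\<close> and one at \<open>i'\<close>.  A letter whose root is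
  \<open>\<plusminus>\<beta>\<close> can be moved to the front of the word, where it becomes \<open>\<sigma>\<close>; hence \<open>r\<^sub>Y(l)\<close> is
  \<open>\<sigma> r\<^sub>X(l)\<close> when \<open>l\<close> is past the first but not past the second of the positions \<open>i\<close> and \<open>i'\<close>,
  and \<open>r\<^sub>X(l)\<close> otherwise (\<open>face_root_flip\<close>).  In particular \<open>r\<^sub>Y(i') = \<plusminus>\<beta>\<close>.

  Compare the two root configuration quivers under the renaming of \<open>i\<close> to \<open>i'\<close>.  If \<open>i\<close> is special,
  the roots of the vertices on one of the two sides of the flip are orthogonal to \<open>\<beta>\<close>, hence fixed
  by \<open>\<sigma>\<close>.  So the roots of all vertices other than \<open>i\<close> are moved by one and the same isometry,
  \<open>\<sigma>\<close> or the identity, and the arrows between these vertices do not change.  At the vertex itself,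
  passing to a \<open>j\<close> between \<open>i\<close> and \<open>i'\<close> changes both the sign of the pairing with \<open>\<plusminus>\<beta>\<close> and the
  order relation; the two changes cancel.  Therefore the arrows at \<open>i\<close> are either all kept or all
  reversed, according to the sign in \<open>r\<^sub>Y(i') = \<plusminus>\<beta>\<close> (\<open>root_quiver_flip\<close>).

  A renaming of vertices that keeps or reverses the connection between each pair of vertices
  induces an isomorphism of subquiver categories (\<open>reversal_iso_subquiver_categories\<close>).  A partial
  isomorphism preserves labels, and a label determines the vertex of the configuration quiver; so it
  relates two connections that lie over the same pair of vertices, and these are both kept or both
  reversed.
\<close>

section \<open>The geometric representation is isometric\<close>

context coxeter_system
begin

abbreviation form :: "real ^ 'n \<Rightarrow> real ^ 'n \<Rightarrow> real" where
  "form \<equiv> cox_form W s"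

definition reflection :: "real ^ 'n \<Rightarrow> real ^ 'n \<Rightarrow> real ^ 'n" where
  "reflection b v = v - (2 * form v b) *\<^sub>R b"

lemma cox_ord_sym: "cox_ord W s i j = cox_ord W s j i"
proof -
  have "inv (s k) = s k" for k
    using simple_closed simple_square by (intro inv_equality) auto
  then have "inv (s i \<otimes> s j) = s j \<otimes> s i"
    using simple_closed by (simp add: inv_mult_group)
  then show ?thesis
    unfolding cox_ord_def using ord_inv[of "s i \<otimes> s j"] simple_closed by simp
qed

lemma form_sym: "form x y = form y x"
proof -
  have "form x y = (\<Sum>j\<in>UNIV. \<Sum>i\<in>UNIV. x $ i * y $ j * - cos (pi / real (cox_ord W s i j)))"
    unfolding cox_form_def by (rule sum.swap)
  also have "\<dots> = form y x"
    unfolding cox_form_def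
    by (intro sum.cong HOL.refl) (metis cox_ord_sym mult.commute)
  finally show ?thesis .
qed

lemma form_add_left: "form (x + y) z = form x z + form y z"
  unfolding cox_form_def sum.distrib[symmetric] by (simp add: distrib_right)

lemma form_scaleR_left: "form (c *\<^sub>R x) z = c * form x z"
  unfolding cox_form_def by (simp add: sum_distrib_left mult.assoc)

lemma form_diff_left: "form (x - y) z = form x z - form y z"
  using form_add_left[of x "(-1) *\<^sub>R y" z] form_scaleR_left[of "-1" y z] by simp

lemma form_diff_right: "form z (x - y) = form z x - form z y"
  using form_diff_left form_sym by metis

lemma form_scaleR_right: "form z (c *\<^sub>R x) = c * form z x"
  using form_scaleR_left form_sym by metis

lemmas form_bilinear = form_diff_left form_diff_right form_scaleR_left form_scaleR_right

lemma form_simple_root: "form (simple_root i) (simple_root i) = 1"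
proof -
  have "cox_ord W s i i = 1"
    unfolding cox_ord_def by (simp add: simple_square)
  then show ?thesis
    unfolding cox_form_def simple_root_def axis_def mult.assoc sum_distrib_left[symmetric]
    by (simp add: if_distrib[of "\<lambda>x. x * _"] if_distrib[of "\<lambda>x. - x"] cong: if_cong)
qed

lemma reflection_isometry:
  assumes "form b b = 1"
  shows "form (reflection b x) (reflection b y) = form x y"
  using assms form_sym[of b y] by (simp add: reflection_def form_bilinear)

lemma reflection_involution:
  assumes "form b b = 1"
  shows "reflection b (reflection b x) = x"
  using assms by (simp add: reflection_def form_bilinear algebra_simps)

lemma reflection_self:
  assumes "form b b = 1"
  shows "reflection b b = - b"
  using assms by (simp add: reflection_def algebra_simps scaleR_2)

lemma reflection_neg: "reflection (- b) = reflection b"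
  using form_scaleR_right[of _ "-1" b] by (auto simp: reflection_def)

lemma simple_reflection_eq: "simple_reflection W s i = reflection (simple_root i)"
  by (auto simp: simple_reflection_def reflection_def)

lemma linear_reflection: "linear (reflection b)"
  by (rule linearI)
    (auto simp: reflection_def form_add_left form_scaleR_left algebra_simps)

lemma linear_word_action: "linear (word_action W s u)"
proof (induction u)
  case Nil
  then show ?case by (simp add: word_action_def linear_iff)
next
  case (Cons i u)
  then have "linear (reflection (simple_root i) \<circ> word_action W s u)"
    by (intro linear_compose linear_reflection)
  then show ?case
    by (simp add: word_action_def simple_reflection_eq comp_def)
qed

lemma word_action_isometry: "form (word_action W s u x) (word_action W s u y) = form x y"
  by (induction u)
    (auto simp: word_action_def simple_reflection_eq reflection_isometry form_simple_root)

text \<open>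
  The conjugate of a simple reflection is the reflection in the transported root.  This moves a
  letter across the word in front of it.
\<close>

lemma word_action_simple_reflection:
  "word_action W s u (simple_reflection W s i x)
     = reflection (word_action W s u (simple_root i)) (word_action W s u x)"
proof -
  interpret linear "word_action W s u" by (rule linear_word_action)
  show ?thesis
    by (simp add: simple_reflection_eq reflection_def diff scale word_action_isometry)
qed

section \<open>Root functions under a flip\<close>

definition prefix_action :: "'n list \<Rightarrow> nat set \<Rightarrow> nat \<Rightarrow> real ^ 'n \<Rightarrow> real ^ 'n" where
  "prefix_action Q I l = word_action W s (nths (take l Q) (- I))"

lemma prefix_action_Suc:
  assumes "l < length Q"
  shows "prefix_action Q I (Suc l) x =
    (if l \<in> I then prefix_action Q I l x else prefix_action Q I l (simple_reflection W s (Q ! l) x))"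
  using assms
  by (auto simp: prefix_action_def word_action_def take_Suc_conv_app_nth nths_append)

definition face_root :: "'n list \<Rightarrow> nat set \<Rightarrow> nat \<Rightarrow> real ^ 'n" where
  "face_root Q I l = prefix_action Q I l (simple_root (Q ! l))"

lemma form_face_root: "form (face_root Q I l) (face_root Q I l) = 1"
  by (simp add: face_root_def prefix_action_def word_action_isometry form_simple_root)

text \<open>
  The letters at \<open>i\<close> and \<open>i'\<close> have roots \<open>\<plusminus>b\<close>, so inserting or deleting either of them multiplies
  the word from the left by the reflection in \<open>b\<close>.  The earlier of the two changes introduces this
  reflection and the later one cancels it.  A letter acts only on later positions; so the range of
  reflected positions contains the later but not the earlier endpoint.
\<close>

lemma prefix_action_flip:
  assumes "i \<in> I" "i' \<notin> I"
    and b: "face_root Q I i = b" and b': "face_root Q I i' = b \<or> face_root Q I i' = - b"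
    and "l \<le> length Q"
  shows "prefix_action Q (insert i' (I - {i})) l x =
    (if min i i' < l \<and> l \<le> max i i' then reflection b (prefix_action Q I l x)
     else prefix_action Q I l x)"
  using \<open>l \<le> length Q\<close>
proof (induction l arbitrary: x)
  case 0
  then show ?case by (simp add: prefix_action_def)
next
  case (Suc l)
  have bb: "form b b = 1" using b form_face_root by blast
  have ii': "i \<noteq> i'" using assms(1,2) by blast
  have move: "prefix_action Q I l (simple_reflection W s (Q ! l) x)
      = reflection b (prefix_action Q I l x)" if "l = i \<or> l = i'"
  proof -
    have "reflection (face_root Q I l) = reflection b"
      using that b b' reflection_neg by metis
    then show ?thesis
      by (simp add: prefix_action_def face_root_def word_action_simple_reflection)
  qed
  have l: "l < length Q" using Suc.prems by simp
  note IH = Suc.IH[OF less_imp_le[OF l]]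
  consider "l \<noteq> i" "l \<noteq> i'" | "l = i" | "l = i'" by blast
  then show ?case
  proof cases
    case 1
    then have "min i i' < Suc l \<and> Suc l \<le> max i i' \<longleftrightarrow> min i i' < l \<and> l \<le> max i i'"
      by (auto simp: min_def max_def)
    with 1 show ?thesis by (simp add: prefix_action_Suc[OF l] IH)
  next
    case 2
    then show ?thesis
      using ii' assms(1) move[OF disjI1[OF 2]] unfolding prefix_action_Suc[OF l] IH
      by (cases "i < i'") (auto simp: reflection_involution[OF bb])
  next
    case 3
    then show ?thesis
      using ii' assms(2) move[OF disjI2[OF 3]] unfolding prefix_action_Suc[OF l] IH
      by (cases "i < i'") (auto simp: reflection_involution[OF bb])
  qed
qed

lemma face_root_flip:
  assumes "i \<in> I" "i' \<notin> I"
    and "face_root Q I i = b" "face_root Q I i' = b \<or> face_root Q I i' = - b"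
    and "l < length Q"
  shows "face_root Q (insert i' (I - {i})) l =
    (if min i i' < l \<and> l \<le> max i i' then reflection b (face_root Q I l) else face_root Q I l)"
  unfolding face_root_def
  by (rule prefix_action_flip) (use assms in auto)

lemma unit_in_span:
  assumes "x \<in> span {b}" "form x x = 1" "form b b = 1"
  shows "x = b \<or> x = - b"
proof -
  obtain c where c: "x = c *\<^sub>R b" using assms(1) by (auto simp: span_singleton)
  then have "c * c = 1" using assms(2,3) by (simp add: form_bilinear)
  then have "c = 1 \<or> c = -1" by (simp add: square_eq_1_iff)
  with c show ?thesis by auto
qed

end

section \<open>Reversing connections of a labelled quiver\<close>

text \<open>
  Each pair of vertices may be kept or reversed independently of the other pairs.  Both directions
  of a pair have to follow the same alternative: if it were chosen separately for \<open>(a, b)\<close> and for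
  \<open>(b, a)\<close>, a one-way arrow could become a two-way one.
\<close>

definition reversal_iso :: "(nat \<Rightarrow> nat) \<Rightarrow> (nat, nat) quiver \<Rightarrow> (nat, nat) quiver \<Rightarrow> bool" where
  "reversal_iso \<phi> G H \<longleftrightarrow> bij_betw \<phi> (verts G) (verts H) \<and>
     (\<forall>a\<in>verts G. \<forall>b\<in>verts G.
        ((\<phi> a, \<phi> b) \<in> arrows H \<longleftrightarrow> (a, b) \<in> arrows G) \<and>
        ((\<phi> b, \<phi> a) \<in> arrows H \<longleftrightarrow> (b, a) \<in> arrows G) \<or>
        ((\<phi> a, \<phi> b) \<in> arrows H \<longleftrightarrow> (b, a) \<in> arrows G) \<and>
        ((\<phi> b, \<phi> a) \<in> arrows H \<longleftrightarrow> (a, b) \<in> arrows G))"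

lemma reversal_iso_inverse:
  assumes "reversal_iso \<phi> G H"
  shows "reversal_iso (inv_into (verts G) \<phi>) H G"
proof -
  let ?\<psi> = "inv_into (verts G) \<phi>"
  have bij: "bij_betw \<phi> (verts G) (verts H)"
    using assms by (simp add: reversal_iso_def)
  have "((?\<psi> a, ?\<psi> b) \<in> arrows G \<longleftrightarrow> (a, b) \<in> arrows H) \<and>
        ((?\<psi> b, ?\<psi> a) \<in> arrows G \<longleftrightarrow> (b, a) \<in> arrows H) \<or>
        ((?\<psi> a, ?\<psi> b) \<in> arrows G \<longleftrightarrow> (b, a) \<in> arrows H) \<and>
        ((?\<psi> b, ?\<psi> a) \<in> arrows G \<longleftrightarrow> (a, b) \<in> arrows H)"
    if "a \<in> verts H" "b \<in> verts H" for a b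
  proof -
    have "?\<psi> a \<in> verts G" "?\<psi> b \<in> verts G"
      using that bij_betw_inv_into[OF bij] by (auto simp: bij_betw_def)
    moreover have "\<phi> (?\<psi> a) = a" "\<phi> (?\<psi> b) = b"
      using that bij by (simp_all add: bij_betw_inv_into_right)
    ultimately show ?thesis
      using assms unfolding reversal_iso_def by metis
  qed
  then show ?thesis
    unfolding reversal_iso_def using bij_betw_inv_into[OF bij] by blast
qed

text \<open>
  A disjoint union of full subquivers of \<open>G\<close> is determined by its vertex set; this is the quiver
  with vertex set \<open>V\<close>.
\<close>

definition copies :: "(nat, nat) quiver \<Rightarrow> (nat \<times> nat) set \<Rightarrow> (nat \<times> nat, nat) quiver" where
  "copies G V =
     \<lparr>verts = V,
      arrows = {((k, a), (k, b)) |k a b. (k, a) \<in> V \<and> (k, b) \<in> V \<and> (a, b) \<in> arrows G},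
      label = restrict snd V\<rparr>"

definition copy_verts :: "nat set list \<Rightarrow> (nat \<times> nat) set" where
  "copy_verts Js = (SIGMA k:{..<length Js}. Js ! k)"

lemma verts_copies [simp]: "verts (copies G V) = V"
  by (simp add: copies_def)

lemma disjoint_union_full_subquivers:
  assumes "label G = restrict id (verts G)" and sub: "\<forall>J\<in>set Js. J \<subseteq> verts G"
  shows "disjoint_union (map (full_subquiver G) Js) = copies G (copy_verts Js)"
proof -
  have nth: "verts G \<inter> Js ! k = Js ! k" if "k < length Js" for k
    using that sub by (meson inf.absorb2 nth_mem)
  have "(SIGMA k:{..<length Js}. verts (map (full_subquiver G) Js ! k)) = copy_verts Js"
    by (auto simp: copy_verts_def full_subquiver_def nth)
  moreover have "(\<lambda>(k, a)\<in>copy_verts Js. label (map (full_subquiver G) Js ! k) a)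
      = restrict snd (copy_verts Js)"
    using assms(1) sub
    by (intro restrict_ext) (auto simp: copy_verts_def full_subquiver_def restrict_def, metis nth_mem subsetD)
  moreover have "{((k, a), (k, b)) |k a b. k < length (map (full_subquiver G) Js)
        \<and> (a, b) \<in> arrows (map (full_subquiver G) Js ! k)}
      = {((k, a), (k, b)) |k a b.
           (k, a) \<in> copy_verts Js \<and> (k, b) \<in> copy_verts Js \<and> (a, b) \<in> arrows G}"
    by (auto simp: copy_verts_def full_subquiver_def)
  ultimately show ?thesis
    unfolding disjoint_union_def copies_def by simp
qed

text \<open>
  Preservation of labels forces a vertex \<open>a\<close> of one copy onto the vertex \<open>a\<close> of another, so a
  partial isomorphism only chooses copies.  It preserves the arrows over \<open>(a, b)\<close> iff it respects
  whether \<open>a\<close> and \<open>b\<close> are taken in a common copy.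
\<close>

lemma partial_isos_copies:
  "f \<in> partial_isos (copies G U) (copies G V) \<longleftrightarrow>
     f \<subseteq> U \<times> V \<and> single_valued f \<and> single_valued (f\<inverse>) \<and>
     (\<forall>k a l b. ((k, a), (l, b)) \<in> f \<longrightarrow> a = b) \<and>
     (\<forall>k l k' l' a b. ((k, a), (l, a)) \<in> f \<longrightarrow> ((k', b), (l', b)) \<in> f \<longrightarrow>
        (a, b) \<in> arrows G \<longrightarrow> (k = k' \<longleftrightarrow> l = l'))"
  (is "?L \<longleftrightarrow> ?R")
proof (cases "f \<subseteq> U \<times> V")
  case True
  have lab: "(\<forall>x y. (x, y) \<in> f \<longrightarrow> label (copies G U) x = label (copies G V) y)
      \<longleftrightarrow> (\<forall>k a l b. ((k, a), (l, b)) \<in> f \<longrightarrow> a = b)"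
    using True by (auto simp: copies_def restrict_def subset_iff)
  show ?thesis
  proof
    assume ?L
    then show ?R
      using lab True unfolding partial_isos_def by (fastforce simp: copies_def)
  next
    assume R: ?R
    have "(x, x') \<in> arrows (copies G U) \<longleftrightarrow> (y, y') \<in> arrows (copies G V)"
      if "(x, y) \<in> f" "(x', y') \<in> f" for x y x' y'
    proof -
      obtain k a l c k' b l' d where xy: "x = (k, a)" "y = (l, c)" "x' = (k', b)" "y' = (l', d)"
        by (metis surj_pair)
      then have "c = a" "d = b" using R that by blast+
      moreover have "x \<in> U" "x' \<in> U" "y \<in> V" "y' \<in> V" using True that by auto
      moreover have "(a, b) \<in> arrows G \<Longrightarrow> k = k' \<longleftrightarrow> l = l'"
        using R that xy \<open>c = a\<close> \<open>d = b\<close> by blast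
      ultimately show ?thesis using xy by (auto simp: copies_def)
    qed
    then show ?L using R lab True unfolding partial_isos_def by auto
  qed
qed (auto simp: partial_isos_def)

lemma inj_on_apsnd:
  assumes "inj_on \<phi> A" "V \<subseteq> UNIV \<times> A"
  shows "inj_on (apsnd \<phi>) V"
proof (rule inj_onI)
  fix x y assume *: "x \<in> V" "y \<in> V" "apsnd \<phi> x = apsnd \<phi> y"
  then have "snd x \<in> A" "snd y \<in> A" using assms(2) by auto
  with * assms(1) show "x = y" by (auto simp: apsnd_def prod_eq_iff dest: inj_onD)
qed

lemma single_valued_map_prod:
  assumes "inj_on h B" "f \<subseteq> B \<times> UNIV" "single_valued f"
  shows "single_valued (map_prod h h ` f)"
proof (rule single_valuedI)
  fix u v w assume "(u, v) \<in> map_prod h h ` f" "(u, w) \<in> map_prod h h ` f"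
  then obtain x y x' z where *: "(x, y) \<in> f" "(x', z) \<in> f" "h x = h x'" "v = h y" "w = h z"
    by auto
  then have "x = x'" using assms(1,2) by (auto dest: inj_onD)
  with * assms(3) show "v = w" by (auto dest: single_valuedD)
qed

lemma map_prod_relcomp:
  assumes "inj_on h B" and f: "f \<subseteq> UNIV \<times> B" and g: "g \<subseteq> B \<times> UNIV"
  shows "map_prod h h ` (f O g) = map_prod h h ` f O map_prod h h ` g"
proof (intro equalityI subsetI)
  fix p assume "p \<in> map_prod h h ` (f O g)"
  then obtain x y z where "(x, y) \<in> f" "(y, z) \<in> g" "p = (h x, h z)" by auto
  then show "p \<in> map_prod h h ` f O map_prod h h ` g" by (auto intro: relcompI)
next
  fix p assume "p \<in> map_prod h h ` f O map_prod h h ` g"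
  then obtain x y y' z where *: "(x, y) \<in> f" "(y', z) \<in> g" "h y = h y'" "p = (h x, h z)" by auto
  then have "y = y'" using assms by (auto dest: inj_onD)
  with * show "p \<in> map_prod h h ` (f O g)" by blast
qed

text \<open>
  The condition that \<open>partial_isos_copies\<close> attaches to an arrow is symmetric in its ends, so it does
  not notice a reversal.
\<close>

lemma partial_isos_reversal:
  assumes rev: "reversal_iso \<phi> G H" and U: "U \<subseteq> UNIV \<times> verts G" and V: "V \<subseteq> UNIV \<times> verts G"
    and f: "f \<in> partial_isos (copies G U) (copies G V)"
  shows "map_prod (apsnd \<phi>) (apsnd \<phi>) ` f
     \<in> partial_isos (copies H (apsnd \<phi> ` U)) (copies H (apsnd \<phi> ` V))"
proof -
  note f = f[unfolded partial_isos_copies]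
  have f': "f \<subseteq> U \<times> V" "single_valued f" "single_valued (f\<inverse>)"
    using f by simp_all
  have "\<forall>k a l b. ((k, a), (l, b)) \<in> f \<longrightarrow> a = b"
    using f by (elim conjE)
  then have lab: "a = b" if "((k, a), (l, b)) \<in> f" for k a l b
    using that by blast
  have "\<forall>k l k' l' a b. ((k, a), (l, a)) \<in> f \<longrightarrow> ((k', b), (l', b)) \<in> f \<longrightarrow>
      (a, b) \<in> arrows G \<longrightarrow> (k = k' \<longleftrightarrow> l = l')"
    using f by (elim conjE)
  then have arr: "k = k' \<longleftrightarrow> l = l'"
    if "((k, a), (l, a)) \<in> f" "((k', b), (l', b)) \<in> f" "(a, b) \<in> arrows G" for k l k' l' a b
    using that by blast
  have inj: "inj_on \<phi> (verts G)"
    using rev by (simp add: reversal_iso_def bij_betw_def)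
  have vert: "a \<in> verts G" if "((k, a), y) \<in> f" for k a y
    using that f'(1) U by blast
  have mem: "\<exists>a\<in>verts G. c = \<phi> a \<and> d = \<phi> a \<and> ((k, a), (l, a)) \<in> f"
    if "((k, c), (l, d)) \<in> map_prod (apsnd \<phi>) (apsnd \<phi>) ` f" for k c l d
    using that lab vert by (auto simp: image_iff) blast+
  show ?thesis
    unfolding partial_isos_copies
  proof (intro conjI allI impI)
    show "map_prod (apsnd \<phi>) (apsnd \<phi>) ` f \<subseteq> apsnd \<phi> ` U \<times> apsnd \<phi> ` V"
      using f'(1) by auto
  next
    show "single_valued (map_prod (apsnd \<phi>) (apsnd \<phi>) ` f)"
      by (rule single_valued_map_prod[OF inj_on_apsnd[OF inj U]]) (use f' in auto)
  next
    have "(map_prod (apsnd \<phi>) (apsnd \<phi>) ` f)\<inverse> = map_prod (apsnd \<phi>) (apsnd \<phi>) ` (f\<inverse>)"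
      by force
    moreover have "single_valued \<dots>"
      by (rule single_valued_map_prod[OF inj_on_apsnd[OF inj V]]) (use f' in auto)
    ultimately show "single_valued ((map_prod (apsnd \<phi>) (apsnd \<phi>) ` f)\<inverse>)" by simp
  next
    fix k c l d
    assume "((k, c), (l, d)) \<in> map_prod (apsnd \<phi>) (apsnd \<phi>) ` f"
    then show "c = d" by (auto dest!: mem simp del: map_prod_simp)
  next
    fix k l k' l' c d
    assume *: "((k, c), (l, c)) \<in> map_prod (apsnd \<phi>) (apsnd \<phi>) ` f"
      "((k', d), (l', d)) \<in> map_prod (apsnd \<phi>) (apsnd \<phi>) ` f" and cd: "(c, d) \<in> arrows H"
    obtain a b where a: "a \<in> verts G" "c = \<phi> a" "((k, a), (l, a)) \<in> f"
      and b: "b \<in> verts G" "d = \<phi> b" "((k', b), (l', b)) \<in> f"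
      using mem[OF *(1)] mem[OF *(2)] by blast
    have "(a, b) \<in> arrows G \<or> (b, a) \<in> arrows G"
      using rev cd a(1,2) b(1,2) unfolding reversal_iso_def by metis
    then show "k = k' \<longleftrightarrow> l = l'"
      using arr a(3) b(3) by blast
  qed
qed

definition quiver_copies_category ::
  "(nat, nat) quiver \<Rightarrow> ((nat \<times> nat, nat) quiver, ((nat \<times> nat) \<times> (nat \<times> nat)) set) cat" where
  "quiver_copies_category G =
     \<lparr>Obj = copies G ` copy_verts ` lists (Pow (verts G)),
      Hom = partial_isos,
      Ide = (\<lambda>A. Id_on (verts A)),
      Comp = (\<lambda>A B C f g. f O g)\<rparr>"

lemma copy_verts_subset: "Js \<in> lists (Pow A) \<Longrightarrow> copy_verts Js \<subseteq> UNIV \<times> A"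
  unfolding copy_verts_def by (auto simp: in_lists_conv_set)

lemma copy_verts_image: "apsnd \<phi> ` copy_verts Js = copy_verts (map (image \<phi>) Js)"
  by (auto simp: copy_verts_def image_iff)

lemma lists_Pow_image: "map (image \<phi>) ` lists (Pow A) = lists (Pow (\<phi> ` A))"
  by (simp only: lists_image[symmetric] image_Pow_surj[OF HOL.refl])

lemma reversal_iso_subquiver_categories:
  assumes rev: "reversal_iso \<phi> G H"
  shows "isomorphic_categories (quiver_copies_category G) (quiver_copies_category H)"
proof -
  let ?\<psi> = "inv_into (verts G) \<phi>"
  let ?T = "\<lambda>\<phi> V. apsnd \<phi> ` V :: (nat \<times> nat) set"
  let ?M = "\<lambda>\<phi> f. map_prod (apsnd \<phi>) (apsnd \<phi>) ` f :: ((nat \<times> nat) \<times> (nat \<times> nat)) set"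
  let ?C = "quiver_copies_category G" and ?D = "quiver_copies_category H"
  let ?F = "\<lambda>A. copies H (?T \<phi> (verts A))"
  have bij: "bij_betw \<phi> (verts G) (verts H)" using rev by (simp add: reversal_iso_def)
  then have inj: "inj_on \<phi> (verts G)" and img: "\<phi> ` verts G = verts H"
    by (auto simp: bij_betw_def)
  have \<psi>\<phi>: "?\<psi> (\<phi> a) = a" if "a \<in> verts G" for a using that inj by simp
  have \<phi>\<psi>: "\<phi> (?\<psi> a) = a" if "a \<in> verts H" for a using that img by (simp add: f_inv_into_f)
  have T: "?T ?\<psi> (?T \<phi> V) = V" if "V \<subseteq> UNIV \<times> verts G" for V
    using that \<psi>\<phi> by (force simp: image_iff)
  have M1: "?M ?\<psi> (?M \<phi> f) = f" if "f \<subseteq> (UNIV \<times> verts G) \<times> (UNIV \<times> verts G)" for f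
    unfolding image_image
    by (rule HOL.trans[OF image_cong[OF HOL.refl, of _ _ id]]) (use that \<psi>\<phi> in \<open>auto simp: subset_iff\<close>)
  have M2: "?M \<phi> (?M ?\<psi> f) = f" if "f \<subseteq> (UNIV \<times> verts H) \<times> (UNIV \<times> verts H)" for f
    unfolding image_image
    by (rule HOL.trans[OF image_cong[OF HOL.refl, of _ _ id]]) (use that \<phi>\<psi> in \<open>auto simp: subset_iff\<close>)
  have obj: "\<exists>V. A = copies G V \<and> V \<subseteq> UNIV \<times> verts G" if "A \<in> Obj ?C" for A
  proof -
    have "A \<in> copies G ` copy_verts ` lists (Pow (verts G))"
      using that by (simp add: quiver_copies_category_def)
    then obtain Js where "A = copies G (copy_verts Js)" "Js \<in> lists (Pow (verts G))"
      by (elim imageE) simp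
    then show ?thesis using copy_verts_subset by blast
  qed
  have TH: "?T \<phi> V \<subseteq> UNIV \<times> verts H" if "V \<subseteq> UNIV \<times> verts G" for V
    using that unfolding img[symmetric] by auto
  have bijF: "bij_betw ?F (Obj ?C) (Obj ?D)"
    unfolding bij_betw_def
  proof
    show "inj_on ?F (Obj ?C)"
    proof (rule inj_onI)
      fix A B assume A: "A \<in> Obj ?C" and B: "B \<in> Obj ?C" and eq: "?F A = ?F B"
      obtain U V where "A = copies G U" "U \<subseteq> UNIV \<times> verts G" "B = copies G V" "V \<subseteq> UNIV \<times> verts G"
        using obj[OF A] obj[OF B] by blast
      moreover have "?T \<phi> (verts A) = ?T \<phi> (verts B)"
        using arg_cong[OF eq, of verts] by simp
      ultimately show "A = B" using T by (metis verts_copies)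
    qed
    have "?F ` Obj ?C = copies H ` copy_verts ` map (image \<phi>) ` lists (Pow (verts G))"
      by (simp add: quiver_copies_category_def image_image copy_verts_image)
    then show "?F ` Obj ?C = Obj ?D"
      by (simp add: quiver_copies_category_def lists_Pow_image img)
  qed
  have bijM: "bij_betw (?M \<phi>) (Hom ?C A B) (Hom ?D (?F A) (?F B))"
    if A: "A \<in> Obj ?C" and B: "B \<in> Obj ?C" for A B
  proof -
    obtain U V where U: "A = copies G U" "U \<subseteq> UNIV \<times> verts G"
      and V: "B = copies G V" "V \<subseteq> UNIV \<times> verts G" using obj[OF A] obj[OF B] by blast
    let ?P = "partial_isos (copies G U) (copies G V)"
    let ?Q = "partial_isos (copies H (?T \<phi> U)) (copies H (?T \<phi> V))"
    have P: "f \<subseteq> (UNIV \<times> verts G) \<times> (UNIV \<times> verts G)" if "f \<in> ?P" for f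
    proof -
      have "f \<subseteq> U \<times> V" using that by (simp add: partial_isos_copies)
      then show ?thesis using U(2) V(2) by blast
    qed
    have Q: "f \<subseteq> (UNIV \<times> verts H) \<times> (UNIV \<times> verts H)" if "f \<in> ?Q" for f
    proof -
      have "f \<subseteq> ?T \<phi> U \<times> ?T \<phi> V" using that by (simp add: partial_isos_copies)
      then show ?thesis using TH[OF U(2)] TH[OF V(2)] by blast
    qed
    have "bij_betw (?M \<phi>) ?P ?Q"
    proof (rule bij_betw_byWitness[where f' = "?M ?\<psi>"])
      show "\<forall>f\<in>?P. ?M ?\<psi> (?M \<phi> f) = f" by (intro ballI M1 P)
      show "\<forall>f\<in>?Q. ?M \<phi> (?M ?\<psi> f) = f" by (intro ballI M2 Q)
      show "?M \<phi> ` ?P \<subseteq> ?Q" 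
        by (rule image_subsetI) (rule partial_isos_reversal[OF rev U(2) V(2)])
      show "?M ?\<psi> ` ?Q \<subseteq> ?P"
      proof (rule image_subsetI)
        fix f assume "f \<in> ?Q"
        then have "?M ?\<psi> f
            \<in> partial_isos (copies G (?T ?\<psi> (?T \<phi> U))) (copies G (?T ?\<psi> (?T \<phi> V)))"
          by (rule partial_isos_reversal[OF reversal_iso_inverse[OF rev] TH[OF U(2)] TH[OF V(2)]])
        then show "?M ?\<psi> f \<in> ?P" by (simp only: T[OF U(2)] T[OF V(2)])
      qed
    qed
    then show ?thesis by (simp add: quiver_copies_category_def U(1) V(1))
  qed
  have ide: "?M \<phi> (Id_on U) = Id_on (?T \<phi> U)" for U
    by (simp add: Id_on_def image_UN)
  have comp: "?M \<phi> (f O g) = ?M \<phi> f O ?M \<phi> g"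
    if A: "A \<in> Obj ?C" and B: "B \<in> Obj ?C" and C: "C \<in> Obj ?C"
      and f: "f \<in> Hom ?C A B" and g: "g \<in> Hom ?C B C" for A B C f g
  proof -
    obtain V where V: "B = copies G V" "V \<subseteq> UNIV \<times> verts G" using obj[OF B] by blast
    have fg: "f \<subseteq> UNIV \<times> V" "g \<subseteq> V \<times> UNIV"
      using f g unfolding quiver_copies_category_def partial_isos_def V(1) by auto
    show ?thesis by (rule map_prod_relcomp[OF inj_on_apsnd[OF inj V(2)] fg])
  qed
  show ?thesis
    unfolding isomorphic_categories_def
  proof (rule exI[of _ ?F], rule exI[of _ "\<lambda>_ _. ?M \<phi>"], intro conjI ballI)
    show "bij_betw ?F (Obj ?C) (Obj ?D)" by (rule bijF)
  next
    fix A B assume "A \<in> Obj ?C" "B \<in> Obj ?C"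
    then show "bij_betw (?M \<phi>) (Hom ?C A B) (Hom ?D (?F A) (?F B))" by (rule bijM)
  next
    fix A
    show "?M \<phi> (Ide ?C A) = Ide ?D (?F A)" by (simp add: quiver_copies_category_def ide)
  next
    fix A B C f g
    assume "A \<in> Obj ?C" "B \<in> Obj ?C" "C \<in> Obj ?C" "f \<in> Hom ?C A B" "g \<in> Hom ?C B C"
    then have "?M \<phi> (f O g) = ?M \<phi> f O ?M \<phi> g" by (rule comp)
    then show "?M \<phi> (Comp ?C A B C f g) = Comp ?D (?F A) (?F B) (?F C) (?M \<phi> f) (?M \<phi> g)"
      by (simp add: quiver_copies_category_def)
  qed
qed

section \<open>The root configuration quiver under a flip\<close>

lemma subquiver_category_eq_copies:
  "subquiver_category X = quiver_copies_category (root_quiver X)"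
proof -
  have label: "label (root_quiver X) = restrict id (verts (root_quiver X))"
    and verts: "verts (root_quiver X) = qface X"
    by (simp_all add: root_quiver_def)
  have eq: "disjoint_union (map (subobject_quiver X) Js) = copies (root_quiver X) (copy_verts Js)"
    if "\<forall>J\<in>set Js. J \<subseteq> qface X" for Js
    using disjoint_union_full_subquivers[OF label] that
    unfolding verts subobject_quiver_def[abs_def] by blast
  have "(\<lambda>Js. disjoint_union (map (subobject_quiver X) Js)) ` {Js. \<forall>J\<in>set Js. J \<subseteq> qface X}
      = (\<lambda>Js. copies (root_quiver X) (copy_verts Js)) ` {Js. \<forall>J\<in>set Js. J \<subseteq> qface X}"
    by (rule image_cong[OF HOL.refl], rule eq, simp)
  moreover have "lists (Pow (qface X)) = {Js. \<forall>J\<in>set Js. J \<subseteq> qface X}"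
    by (auto simp: in_lists_conv_set)
  ultimately have "{disjoint_union (map (subobject_quiver X) Js) |Js. \<forall>J\<in>set Js. J \<subseteq> qface X}
      = copies (root_quiver X) ` copy_verts ` lists (Pow (qface X))"
    by (simp add: setcompr_eq_image image_image)
  then show ?thesis
    by (simp add: subquiver_category_def quiver_copies_category_def verts)
qed

lemma root_quiver_flip:
  fixes X Y :: "('w, 'n::finite) quadruple"
  assumes cox: "coxeter_system (qgroup X) (qsimple X)"
    and face: "qface X \<subseteq> {..<length (qword X)}"
    and special: "special_vertex X i" and flip: "flippable_flat X i i'"
    and Y: "qgroup Y = qgroup X" "qsimple Y = qsimple X" "qword Y = qword X"
      "qface Y = (qface X - {i}) \<union> {i'}"
  shows "reversal_iso (id(i := i')) (root_quiver X) (root_quiver Y)"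
proof -
  interpret coxeter_system "qgroup X" "qsimple X" by (rule cox)
  define I where "I = qface X"
  define r where "r = root_fun X"
  define t where "t = root_fun Y"
  define b where "b = r i"
  have r_face: "r = face_root (qword X) I"
    unfolding r_def I_def by (auto simp: root_fun_def face_root_def prefix_action_def)
  have t_face: "t = face_root (qword X) (insert i' (I - {i}))"
    unfolding t_def I_def using Y by (auto simp: root_fun_def face_root_def prefix_action_def)
  have i: "i \<in> I" and i': "i' \<notin> I" and i'_length: "i' < length (qword X)"
    and fl: "flat X (span {r i}) = {i, i'}"
    using flip by (auto simp: flippable_flat_def I_def r_def)
  have unit: "form (r l) (r l) = 1" for l by (simp add: r_face form_face_root)
  then have bb: "form b b = 1" by (simp add: b_def)
  have "r i' \<in> span {b}" using fl by (auto simp: flat_def b_def r_def)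
  then have ri': "r i' = b \<or> r i' = - b" using unit_in_span unit bb by blast
  have t: "t l = (if min i i' < l \<and> l \<le> max i i' then reflection b (r l) else r l)"
    if "l < length (qword X)" for l
    unfolding t_face r_face
    by (rule face_root_flip) (use i i' ri' that in \<open>auto simp: r_face b_def\<close>)
  let ?inside = "\<lambda>j. min i i' < j \<and> j < max i i'"
  have tj: "t j = (if ?inside j then reflection b (r j) else r j)" if "j \<in> I - {i}" for j
  proof -
    have "j \<noteq> i" "j \<noteq> i'" "j < length (qword X)" using that i' face I_def by auto
    then show ?thesis using t by (auto simp: max_def)
  qed
  have "t i' = r i' \<or> t i' = - r i'"
    using t[OF i'_length] ri' reflection_self[OF bb] reflection_self[of "- b"] reflection_neg[of b] bb
    form_scaleR_left[of "-1" b] form_scaleR_right[of _ "-1" b]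
    by auto
  then obtain e :: real where e: "t i' = e *\<^sub>R b" "e = 1 \<or> e = -1"
    using ri' by (metis scaleR_minus_left scaleR_one minus_minus)
  have refl_b: "form b (reflection b x) = - form b x" for x
    using bb form_sym[of x b] by (simp add: reflection_def form_bilinear)
  have adj: "j \<in> adjacent (root_quiver X) i \<longleftrightarrow> form (r j) b \<noteq> 0" if "j \<in> I - {i}" for j
    using that i form_sym[of "r j" b]
    by (auto simp: adjacent_def root_quiver_def I_def r_def b_def zero_less_mult_iff)
  \<comment> \<open>Specialness makes the same isometry apply to all the other roots.\<close>
  have "(\<forall>j\<in>I - {i}. t j = r j) \<or> (\<forall>j\<in>I - {i}. t j = reflection b (r j))"
  proof -
    obtain i'' where i'': "flippable_flat X i i''"
      and side: "adjacent (root_quiver X) i \<subseteq> reflection_interval i i'' \<or>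
        adjacent (root_quiver X) i \<subseteq> stable_interval X i i''"
      using special by (auto simp: special_vertex_def)
    have "{i, i'} = {i, i''}" "i'' \<noteq> i"
      using i'' fl i by (auto simp: flippable_flat_def r_def I_def)
    then have "i'' = i'" by auto
    have orth: "reflection b (r j) = r j" if "j \<in> I - {i}" "j \<notin> adjacent (root_quiver X) i" for j
      using that adj by (simp add: reflection_def)
    from side show ?thesis
    proof
      assume "adjacent (root_quiver X) i \<subseteq> reflection_interval i i''"
      then have "?inside j" if "j \<in> I - {i}" "j \<in> adjacent (root_quiver X) i" for j
        using that i' \<open>i'' = i'\<close> by (force simp: reflection_interval_def split: if_splits)
      then show ?thesis using tj orth by metis
    next
      assume "adjacent (root_quiver X) i \<subseteq> stable_interval X i i''"
      then have "\<not> ?inside j" if "j \<in> adjacent (root_quiver X) i" for j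
        using that \<open>i'' = i'\<close>
        by (force simp: stable_interval_def reflection_interval_def split: if_splits)
      then show ?thesis using tj orth by metis
    qed
  qed
  then have others: "form (t j) (t k) = form (r j) (r k)" if "j \<in> I - {i}" "k \<in> I - {i}" for j k
    using that reflection_isometry[OF bb] by metis
  \<comment> \<open>For \<open>j\<close> strictly between \<open>i\<close> and \<open>i'\<close> both factors of the product change sign.\<close>
  have at_i: "sgn ((real i' - real j) * form (t i') (t j))
      = e * sgn ((real i - real j) * form (r i) (r j))" if "j \<in> I - {i}" for j
  proof -
    have "j \<noteq> i" "j \<noteq> i'" using that i' by auto
    then have "sgn (real i' - real j) = (if ?inside j then - 1 else 1) * sgn (real i - real j)"
      by (auto simp: sgn_real_def min_def max_def split: if_splits)
    moreover have "form (t i') (t j) = (if ?inside j then - 1 else 1) * e * form (r i) (r j)"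
      by (simp add: tj[OF that] e(1) b_def[symmetric] refl_b form_scaleR_left)
    moreover have "sgn e = e" using e(2) by auto
    ultimately show ?thesis by (simp add: sgn_mult)
  qed
  let ?\<phi> = "id(i := i')"
  have GX: "(j, k) \<in> arrows (root_quiver X) \<longleftrightarrow> (real j - real k) * form (r j) (r k) > 0"
    if "j \<in> I" "k \<in> I" for j k
    using that by (simp add: root_quiver_def I_def r_def)
  have GY: "(j, k) \<in> arrows (root_quiver Y) \<longleftrightarrow> (real j - real k) * form (t j) (t k) > 0"
    if "j \<in> (I - {i}) \<union> {i'}" "k \<in> (I - {i}) \<union> {i'}" for j k
    using that Y by (simp add: root_quiver_def I_def t_def)
  have swap: "(real j - real k) * form x y = - ((real k - real j) * form y x)" for j k x y
    using form_sym[of x y] by (simp add: algebra_simps)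
  have bij: "bij_betw ?\<phi> I ((I - {i}) \<union> {i'})"
    using i i' by (auto simp: bij_betw_def inj_on_def)
  have ends: "((i', k) \<in> arrows (root_quiver Y) \<longleftrightarrow> (i, k) \<in> arrows (root_quiver X)) \<and>
      ((k, i') \<in> arrows (root_quiver Y) \<longleftrightarrow> (k, i) \<in> arrows (root_quiver X)) \<or>
      ((i', k) \<in> arrows (root_quiver Y) \<longleftrightarrow> (k, i) \<in> arrows (root_quiver X)) \<and>
      ((k, i') \<in> arrows (root_quiver Y) \<longleftrightarrow> (i, k) \<in> arrows (root_quiver X))"
    if "k \<in> I - {i}" for k
  proof -
    have pos: "x > 0 \<longleftrightarrow> sgn x = 1" and neg: "- x > 0 \<longleftrightarrow> sgn x = - 1" for x :: real
      by (simp_all add: sgn_1_pos sgn_1_neg)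
    have ki: "k \<in> I" "k \<in> (I - {i}) \<union> {i'}" "i' \<in> (I - {i}) \<union> {i'}" using that by auto
    show ?thesis
      using e(2) at_i[OF that]
      unfolding GX[OF i ki(1)] GX[OF ki(1) i] GY[OF ki(3,2)] GY[OF ki(2,3)]
        swap[of k i] swap[of k i'] pos neg
      by (auto simp: minus_equation_iff)
  qed
  show ?thesis
    unfolding reversal_iso_def
  proof (intro conjI ballI)
    show "bij_betw ?\<phi> (verts (root_quiver X)) (verts (root_quiver Y))"
      using bij Y by (simp add: root_quiver_def I_def)
  next
    fix j k assume "j \<in> verts (root_quiver X)" "k \<in> verts (root_quiver X)"
    then have jk: "j \<in> I" "k \<in> I" by (simp_all add: root_quiver_def I_def)
    consider "j = i" "k = i" | "j = i" "k \<noteq> i" | "j \<noteq> i" "k = i" | "j \<noteq> i" "k \<noteq> i" by blast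
    then show "((?\<phi> j, ?\<phi> k) \<in> arrows (root_quiver Y) \<longleftrightarrow> (j, k) \<in> arrows (root_quiver X)) \<and>
        ((?\<phi> k, ?\<phi> j) \<in> arrows (root_quiver Y) \<longleftrightarrow> (k, j) \<in> arrows (root_quiver X)) \<or>
        ((?\<phi> j, ?\<phi> k) \<in> arrows (root_quiver Y) \<longleftrightarrow> (k, j) \<in> arrows (root_quiver X)) \<and>
        ((?\<phi> k, ?\<phi> j) \<in> arrows (root_quiver Y) \<longleftrightarrow> (j, k) \<in> arrows (root_quiver X))"
    proof cases
      case 1
      then show ?thesis by (simp add: root_quiver_def)
    next
      case 2
      then show ?thesis using ends[of k] jk by simp
    next
      case 3
      then show ?thesis using ends[of j] jk by auto
    next
      case 4
      then show ?thesis using jk by (simp add: GX GY others)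
    qed
  qed
qed

theorem proposition3p29:
  fixes W :: "'w monoid" and s :: "'n::finite \<Rightarrow> 'w" and Q :: "'n list" and \<pi> :: 'w
    and I :: "nat set" and i i' :: nat and X Y :: "('w, 'n) quadruple"
  assumes "X = \<lparr>qgroup = W, qsimple = s, qword = Q, qelem = \<pi>, qface = I\<rparr>"
    and "X \<in> D_fin"
    and "longest_element W s \<pi>"
    and "special_vertex X i"
    and "flippable_flat X i i'"
    and "Y = \<lparr>qgroup = W, qsimple = s, qword = Q, qelem = \<pi>, qface = (I - {i}) \<union> {i'}\<rparr>"
  shows "isomorphic_categories (subquiver_category X) (subquiver_category Y)"
proof -
  have "is_quadruple X" using assms(2) by (simp add: D_fin_def)
  then have "coxeter_system (qgroup X) (qsimple X)" "qface X \<subseteq> {..<length (qword X)}"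
    by (simp_all add: is_quadruple_def maximal_face_def subword_complex_def)
  then have "reversal_iso (id(i := i')) (root_quiver X) (root_quiver Y)"
    using assms(4,5) by (rule root_quiver_flip) (simp_all add: assms(1,6))
  then show ?thesis
    by (simp add: subquiver_category_eq_copies reversal_iso_subquiver_categories)
qed

end
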